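(* Let $p>0$, let $J\subset\mathbb{R}^+$ be an interval with $(0,1)\subset J$, let $K\subset\mathbb{R}^+$ be a $p$-convex set, let $h:J\to\mathbb{R}^+$ be a non-zero super-multiplicative function, and let $f\in opgx(p,h,K)$. Then for any $k$ positive semidefinite matrices $A_1,\dots,A_k$ (of the same order) with spectra in $K$ and any $\alpha_1,\dots,\alpha_k\in(0,1)$ satisfying $\sum_{i=1}^k\alpha_i=1$, $$f\Big(\Big[\sum_{i=1}^k\alpha_iA_i^p\Big]^{1/p}\Big)\le\sum_{i=1}^k h(\alpha_i)f(A_i).$$
   Context: $\mathbb{R}^+=[0,\infty)$. $\mathbb{M}_n$ is the space of $n\times n$ complex matrices, $\mathbb{M}_n^+$ the set of positive semidefinite ones; $A\le B$ means $B-A\in\mathbb{M}_n^+$; $\sigma(A)$ is the spectrum; functions of self-adjoint matrices are defined by functional calculus. A set $K\subset\mathbb{R}^+$ is $p$-convex if $(\lambda x^p+(1-\lambda)y^p)^{1/p}\in K$ for all $x,y\in K$, $\lambda\in[0,1]$. A function $h:J\to\mathbb{R}^+$ is super-multiplicative if $h(xy)\ge h(x)h(y)$ for all $x,y\in J$ (with $xy\in J$). For a non-zero (i.e. not identically zero) super-multiplicative $h:J\to\mathbb{R}^+$, a non-negative continuous function $f:K\to\mathbb{R}$ is operator $(p,h)$-convex, written $f\in opgx(p,h,K)$, if $$f\big([\alpha A^p+(1-\alpha)B^p]^{1/p}\big)\le h(\alpha)f(A)+h(1-\alpha)f(B)$$ for every $n\ge1$, all $A,B\in\mathbb{M}_n^+$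 with $\sigma(A),\sigma(B)\subset K$, and all $\alpha\in(0,1)$. *)

theory Defs
  imports
    "HOL-Analysis.Topology_Euclidean_Space"
    "Jordan_Normal_Form.Schur_Decomposition"
    "Jordan_Normal_Form.Spectral_Radius"
begin

definition hermitian_mat :: "nat \<Rightarrow> complex mat \<Rightarrow> bool" where
  "hermitian_mat n A \<longleftrightarrow> A \<in> carrier_mat n n \<and> mat_adjoint A = A"

definition psd_mats :: "nat \<Rightarrow> complex mat set" where
  "psd_mats n = {A. hermitian_mat n A \<and> (\<forall>v \<in> carrier_vec n. 0 \<le> Re ((A *\<^sub>v v) \<bullet>c v))}"

text \<open>The Loewner order. It is not the order \<open>\<le>\<close> of type \<open>mat\<close>, which is entrywise.\<close>

definition loewner_le :: "nat \<Rightarrow> complex mat \<Rightarrow> complex mat \<Rightarrow> bool" where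
  "loewner_le n A B \<longleftrightarrow> A \<in> carrier_mat n n \<and> B \<in> carrier_mat n n \<and> B - A \<in> psd_mats n"

definition spectrum_in :: "complex mat \<Rightarrow> real set \<Rightarrow> bool" where
  "spectrum_in A K \<longleftrightarrow> spectrum A \<subseteq> complex_of_real ` K"

definition unitary_mat :: "nat \<Rightarrow> complex mat \<Rightarrow> bool" where
  "unitary_mat n U \<longleftrightarrow> U \<in> carrier_mat n n \<and> mat_adjoint U * U = 1\<^sub>m n \<and> U * mat_adjoint U = 1\<^sub>m n"

text \<open>\<open>U diag(d 0, \<dots>, d (n-1)) U\<^sup>*\<close>, with real \<open>d i\<close>.\<close>

definition unitary_diag :: "nat \<Rightarrow> complex mat \<Rightarrow> (nat \<Rightarrow> real) \<Rightarrow> complex mat" where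
  "unitary_diag n U d = U * mat_diag n (\<lambda>i. complex_of_real (d i)) * mat_adjoint U"

text \<open>Functional calculus for a Hermitian matrix \<open>A = U diag(d) U\<^sup>*\<close>:
  \<open>f(A) = U diag(f \<circ> d) U\<^sup>*\<close>. The result does not depend on the diagonalization
  (lemma \<open>mat_fun_eq\<close>), and it depends only on the values of \<open>f\<close> on the spectrum of \<open>A\<close>.\<close>

definition mat_fun :: "(real \<Rightarrow> real) \<Rightarrow> complex mat \<Rightarrow> complex mat" where
  "mat_fun f A = (THE B. \<exists>U d. unitary_mat (dim_row A) U \<and>
      A = unitary_diag (dim_row A) U d \<and> B = unitary_diag (dim_row A) U (f \<circ> d))"

definition mat_powr :: "complex mat \<Rightarrow> real \<Rightarrow> complex mat" where
  "mat_powr A p = mat_fun (\<lambda>x. x powr p) A"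

definition mat_sum :: "nat \<Rightarrow> ('i \<Rightarrow> complex mat) \<Rightarrow> 'i set \<Rightarrow> complex mat" where
  "mat_sum n F I = finsum (module_mat TYPE(complex) n n) F I"

definition p_convex :: "real \<Rightarrow> real set \<Rightarrow> bool" where
  "p_convex p K \<longleftrightarrow> K \<subseteq> {0..} \<and>
     (\<forall>x\<in>K. \<forall>y\<in>K. \<forall>t\<in>{0..1}. (t * x powr p + (1 - t) * y powr p) powr (1 / p) \<in> K)"

definition super_multiplicative_on :: "real set \<Rightarrow> (real \<Rightarrow> real) \<Rightarrow> bool" where
  "super_multiplicative_on J h \<longleftrightarrow> (\<forall>x\<in>J. \<forall>y\<in>J. x * y \<in> J \<longrightarrow> h (x * y) \<ge> h x * h y)"

text \<open>Only the values of \<open>h\<close> on \<open>(0,1)\<close> enter here; the domain \<open>J\<close> of \<open>h\<close> and the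
  hypotheses on \<open>h\<close> are stated separately.\<close>

definition opgx :: "real \<Rightarrow> (real \<Rightarrow> real) \<Rightarrow> real set \<Rightarrow> (real \<Rightarrow> real) set" where
  "opgx p h K = {f. continuous_on K f \<and> (\<forall>x\<in>K. 0 \<le> f x) \<and>
     (\<forall>n\<ge>1. \<forall>A \<in> psd_mats n. \<forall>B \<in> psd_mats n. \<forall>\<alpha>\<in>{0<..<1}.
        spectrum_in A K \<longrightarrow> spectrum_in B K \<longrightarrow>
        loewner_le n
          (mat_fun f (mat_powr (complex_of_real \<alpha> \<cdot>\<^sub>m mat_powr A p
              + complex_of_real (1 - \<alpha>) \<cdot>\<^sub>m mat_powr B p) (1 / p)))
          (complex_of_real (h \<alpha>) \<cdot>\<^sub>m mat_fun f A
              + complex_of_real (h (1 - \<alpha>)) \<cdot>\<^sub>m mat_fun f B))}"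

lemma mat_adjoint_carrier: "A \<in> carrier_mat n n \<Longrightarrow> mat_adjoint A \<in> carrier_mat n n"
  unfolding mat_adjoint_def by auto

lemma unitary_diag_unique:
  assumes U: "unitary_mat n U" and V: "unitary_mat n V"
    and eq: "unitary_diag n U d = unitary_diag n V e"
  shows "unitary_diag n U (f \<circ> d) = unitary_diag n V (f \<circ> e)"
proof -
  let ?D = "\<lambda>d :: nat \<Rightarrow> real. mat_diag n (\<lambda>i. complex_of_real (d i))"
  define Us where "Us = mat_adjoint U"
  define Vs where "Vs = mat_adjoint V"
  have c: "U \<in> carrier_mat n n" "V \<in> carrier_mat n n" "Us \<in> carrier_mat n n" "Vs \<in> carrier_mat n n"
    using U V mat_adjoint_carrier unfolding unitary_mat_def Us_def Vs_def by auto
  have i: "Us * U = 1\<^sub>m n" "U * Us = 1\<^sub>m n" "Vs * V = 1\<^sub>m n" "V * Vs = 1\<^sub>m n"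
    using U V unfolding unitary_mat_def Us_def Vs_def by auto
  have D: "?D d \<in> carrier_mat n n" for d by simp
  define W where "W = Vs * U"
  have W: "W \<in> carrier_mat n n" unfolding W_def using c by simp
  note a = assoc_mult_mat[of _ n n _ n _ n]
  have [simp]: "X * Y \<in> carrier_mat n n" if "X \<in> carrier_mat n n" "Y \<in> carrier_mat n n"
    for X Y :: "complex mat" using that by simp
  have "W * ?D d = Vs * (U * ?D d * Us) * U"
    unfolding W_def using c D i by (simp add: a right_mult_one_mat[OF D])
  also have "U * ?D d * Us = V * ?D e * Vs"
    using eq unfolding unitary_diag_def Us_def Vs_def .
  also have "Vs * (V * ?D e * Vs) * U = (Vs * V) * ?D e * (Vs * U)"
    using c D by (simp add: a)
  also have "\<dots> = ?D e * W" unfolding i W_def[symmetric] by (simp add: left_mult_one_mat[OF D])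
  finally have WD: "W * ?D d = ?D e * W" .
  have WE: "W * ?D g = mat n n (\<lambda>(i,j). W $$ (i,j) * complex_of_real (g j))"
    "?D g * W = mat n n (\<lambda>(i,j). complex_of_real (g i) * W $$ (i,j))" for g
    using mat_diag_mult_right[OF W] mat_diag_mult_left[OF W] by auto
  have "W $$ (i,j) * complex_of_real (d j) = complex_of_real (e i) * W $$ (i,j)"
    if "i < n" "j < n" for i j
    using arg_cong[OF WD, of "\<lambda>M. M $$ (i,j)"] that unfolding WE by simp
  then have "W $$ (i,j) = 0 \<or> d j = e i" if "i < n" "j < n" for i j
    using that by fastforce
  then have "W * ?D (f \<circ> d) = ?D (f \<circ> e) * W"
    unfolding WE by (intro eq_matI) (auto, metis)
  then have "V * (W * ?D (f \<circ> d)) * Us = V * (?D (f \<circ> e) * W) * Us" by simp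
  moreover have "V * (W * ?D (f \<circ> d)) * Us = (V * Vs) * (U * ?D (f \<circ> d) * Us)"
    unfolding W_def using c D by (simp add: a)
  moreover have "V * (?D (f \<circ> e) * W) * Us = V * ?D (f \<circ> e) * Vs * (U * Us)"
    unfolding W_def using c D by (simp add: a)
  ultimately show ?thesis
    unfolding unitary_diag_def Us_def[symmetric] Vs_def[symmetric] i
    using c D by simp
qed

lemma mat_fun_eq:
  assumes "unitary_mat n U"
  shows "mat_fun f (unitary_diag n U d) = unitary_diag n U (f \<circ> d)"
proof -
  have n: "dim_row (unitary_diag n U d) = n"
    using assms unfolding unitary_diag_def unitary_mat_def by auto
  show ?thesis
    unfolding mat_fun_def n
  proof (rule the_equality)
    show "\<exists>Ua da. unitary_mat n Ua \<and> unitary_diag n U d = unitary_diag n Ua da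
        \<and> unitary_diag n U (f \<circ> d) = unitary_diag n Ua (f \<circ> da)"
      using assms by blast
  qed (auto dest: unitary_diag_unique[OF assms, where f = f])
qed

end

(* Induction on the number of matrices, starting from the two matrices of the definition of
   operator (p,h)-convexity. With b = alpha 1 + ... + alpha k < 1, the matrix
   C = (sum (alpha i / b) (A i)^p)^(1/p) again has its spectrum in K, because x^p maps a p-convex
   K onto a convex set and the eigenvalues of a convex combination of Hermitian matrices are
   averages of theirs. The definition applied to C and A (k+1), the induction hypothesis for f(C),
   and h b * h (alpha i / b) <= h (alpha i) together with f (A i) >= 0 give the step.
   Diagonalizing a Hermitian matrix is done by deflation along one unit eigenvector. *)
theory Submission
  imports Defs "HOL-Analysis.Convex"
begin

section \<open>Diagonalization of Hermitian matrices\<close>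

lemma mat_adjoint_dim [simp]:
  "dim_row (mat_adjoint A) = dim_col A" "dim_col (mat_adjoint A) = dim_row A"
  unfolding mat_adjoint_def by auto

lemma mat_adjoint_in_carrier [simp]:
  "A \<in> carrier_mat nr nc \<Longrightarrow> mat_adjoint A \<in> carrier_mat nc nr"
  by auto

lemma index_mat_adjoint [simp]:
  "i < dim_col A \<Longrightarrow> j < dim_row A \<Longrightarrow> mat_adjoint A $$ (i, j) = conjugate (A $$ (j, i))"
  unfolding mat_adjoint_def by (simp add: mat_of_rows_index)

lemma mat_adjoint_adjoint [simp]: "mat_adjoint (mat_adjoint A) = A"
  by (intro eq_matI) auto

lemma mat_adjoint_add:
  assumes "A \<in> carrier_mat nr nc" "B \<in> carrier_mat nr nc"
  shows "mat_adjoint (A + B) = mat_adjoint A + mat_adjoint B"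
  using assms by (intro eq_matI) (auto simp: conjugate_dist_add)

lemma mat_adjoint_smult:
  fixes A :: "complex mat"
  shows "mat_adjoint (c \<cdot>\<^sub>m A) = cnj c \<cdot>\<^sub>m mat_adjoint A"
  by (intro eq_matI) auto

lemma mat_adjoint_mult:
  fixes A B :: "complex mat"
  assumes "A \<in> carrier_mat nr m" "B \<in> carrier_mat m nc"
  shows "mat_adjoint (A * B) = mat_adjoint B * mat_adjoint A"
  using assms by (intro eq_matI) (auto simp: scalar_prod_def mult.commute intro!: sum.cong)

text \<open>Interchanging the row sum and the column sum gives this. It is what makes unitary
  matrices preserve the form and what lets quadratic forms be computed in eigenvector
  coordinates.\<close>

lemma scalar_prod_mat_adjoint:
  fixes A :: "complex mat"
  assumes A: "A \<in> carrier_mat nr nc" and v: "v \<in> carrier_vec nc" and w: "w \<in> carrier_vec nr"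
  shows "(A *\<^sub>v v) \<bullet>c w = v \<bullet>c (mat_adjoint A *\<^sub>v w)"
proof -
  have "(A *\<^sub>v v) \<bullet>c w = (\<Sum>i<nr. \<Sum>j<nc. A $$ (i,j) * v $ j * cnj (w $ i))"
    using assms by (auto simp: scalar_prod_def sum_distrib_right lessThan_atLeast0 intro!: sum.cong)
  also have "\<dots> = (\<Sum>j<nc. \<Sum>i<nr. A $$ (i,j) * v $ j * cnj (w $ i))"
    by (rule sum.swap)
  also have "\<dots> = v \<bullet>c (mat_adjoint A *\<^sub>v w)"
    using assms
    by (auto simp: scalar_prod_def sum_distrib_left lessThan_atLeast0 algebra_simps intro!: sum.cong)
  finally show ?thesis .
qed

lemma mult_square_mat [simp]:
  "A \<in> carrier_mat n n \<Longrightarrow> B \<in> carrier_mat n n \<Longrightarrow> A * B \<in> carrier_mat n n"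
  by simp

section \<open>Unitary conjugates of real diagonal matrices and the spectral theorem\<close>

lemma dim_unitary_diag [simp]:
  "dim_row (unitary_diag n U d) = dim_row U" "dim_col (unitary_diag n U d) = dim_row U"
  unfolding unitary_diag_def by auto

lemma unitary_diag_in_carrier [simp]:
  "U \<in> carrier_mat n n \<Longrightarrow> unitary_diag n U d \<in> carrier_mat n n"
  unfolding unitary_diag_def by simp

lemma unitary_matD:
  assumes "unitary_mat n U"
  shows "U \<in> carrier_mat n n" "mat_adjoint U \<in> carrier_mat n n"
    "mat_adjoint U * U = 1\<^sub>m n" "U * mat_adjoint U = 1\<^sub>m n"
  using assms unfolding unitary_mat_def by auto

text \<open>A left inverse of a square matrix is also a right inverse, so one of the two products
  suffices.\<close>

lemma unitary_matI:
  assumes "U \<in> carrier_mat n n" "mat_adjoint U * U = 1\<^sub>m n"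
  shows "unitary_mat n U"
  using assms mat_mult_left_right_inverse[of "mat_adjoint U" n U]
  unfolding unitary_mat_def by simp

lemma unitary_mat_mult:
  assumes U: "unitary_mat n U" and V: "unitary_mat n V"
  shows "unitary_mat n (U * V)"
proof (rule unitary_matI)
  note u = unitary_matD[OF U] note v = unitary_matD[OF V]
  show "U * V \<in> carrier_mat n n" using u v by simp
  have "mat_adjoint (U * V) * (U * V) = mat_adjoint V * mat_adjoint U * (U * V)"
    using u v by (simp add: mat_adjoint_mult)
  also have "\<dots> = mat_adjoint V * (mat_adjoint U * U) * V"
    using u(1,2) v(1,2) by (simp add: assoc_mult_mat[of _ n n _ n _ n])
  also have "\<dots> = 1\<^sub>m n" using u v by simp
  finally show "mat_adjoint (U * V) * (U * V) = 1\<^sub>m n" .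
qed

lemma unitary_diag_index:
  assumes "U \<in> carrier_mat n n" "i < n" "j < n"
  shows "unitary_diag n U d $$ (i,j) = (\<Sum>k<n. U $$ (i,k) * complex_of_real (d k) * cnj (U $$ (j,k)))"
  using assms unfolding unitary_diag_def
  by (auto simp: scalar_prod_def mat_diag_mult_right[OF assms(1)] lessThan_atLeast0 intro!: sum.cong)

text \<open>The sequence \<open>d\<close> is a total function on the naturals, but only its first
  \<open>n\<close> values reach the matrix.\<close>

lemma unitary_diag_cong:
  assumes "U \<in> carrier_mat n n" "\<And>i. i < n \<Longrightarrow> d i = e i"
  shows "unitary_diag n U d = unitary_diag n U e"
  using assms
  by (intro eq_matI) (simp_all add: unitary_diag_index[OF assms(1)] cong: sum.cong_simp)

lemma hermitian_mat_unitary_diag: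
  assumes "U \<in> carrier_mat n n"
  shows "hermitian_mat n (unitary_diag n U d)"
  using assms unfolding hermitian_mat_def
  by (auto intro!: sum.cong simp: unitary_diag_index algebra_simps)

text \<open>Complete \<open>v\<close> to a basis, orthogonalize by Gram-Schmidt and normalize.
  Gram-Schmidt keeps the first vector, so the first column is \<open>v\<close> up to the normalizing
  factor.\<close>

lemma normalized_col_basis:
  fixes v :: "complex vec"
  assumes v: "v \<in> carrier_vec n" "v \<noteq> 0\<^sub>v n"
  shows "\<exists>W c. unitary_mat n W \<and> 0 < n \<and> col W 0 = c \<cdot>\<^sub>v v"
proof -
  interpret cof_vec_space n "TYPE(complex)" .
  define b where "b = basis_completion v"
  define ws where "ws = gram_schmidt n b"
  from basis_completion[OF v, folded b_def]
  have dist: "distinct b" and indep: "\<not> lin_dep (set b)" and b: "set b \<subseteq> carrier_vec n"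
    and hdb: "hd b = v" and len: "length b = n" by auto
  from v have n: "0 < n" by (cases n) auto
  from n len hdb obtain vs where bv: "b = v # vs" by (cases b) auto
  from gram_schmidt_result[OF b dist indep refl, folded ws_def]
  have ws: "set ws \<subseteq> carrier_vec n" "corthogonal ws" "length ws = n"
    using len by auto
  have hd: "ws ! 0 = v"
    using gram_schmidt_hd[OF v(1), of vs] n ws(3) unfolding ws_def bv
    by (metis hd_conv_nth length_greater_0_conv)
  have wi: "ws ! i \<in> carrier_vec n" if "i < n" for i using ws that by auto
  \<comment> \<open>Gram-Schmidt yields orthogonal vectors of arbitrary length; \<open>c i\<close>
    is the reciprocal of the norm of the \<open>i\<close>-th one.\<close>
  define c where "c i = 1 / complex_of_real (sqrt (Re (ws ! i \<bullet>c ws ! i)))" for i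
  define W where "W = mat_of_cols n (map (\<lambda>i. c i \<cdot>\<^sub>v ws ! i) [0..<n])"
  have W: "W \<in> carrier_mat n n" unfolding W_def by auto
  have col: "col W i = c i \<cdot>\<^sub>v ws ! i" if "i < n" for i
    unfolding W_def using that wi by (subst col_mat_of_cols) auto
  have "unitary_mat n W"
  proof (rule unitary_matI[OF W], intro eq_matI)
    fix i j assume "i < dim_row (1\<^sub>m n :: complex mat)" "j < dim_col (1\<^sub>m n :: complex mat)"
    then have ij: "i < n" "j < n" by auto
    \<comment> \<open>The indices change places because \<open>\<bullet>c\<close> conjugates its
      second argument, while the adjoint conjugates the column belonging to the row index
      \<open>i\<close>.\<close>
    have "(mat_adjoint W * W) $$ (i,j) = col W j \<bullet>c col W i"
      using W ij by (auto simp: scalar_prod_def intro!: sum.cong)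
    also have "\<dots> = c j * cnj (c i) * (ws ! j \<bullet>c ws ! i)"
      using carrier_vecD[OF wi[OF ij(1)]] carrier_vecD[OF wi[OF ij(2)]]
      by (simp add: col ij conjugate_smult_vec scalar_prod_def sum_distrib_left algebra_simps)
    also have "\<dots> = 1\<^sub>m n $$ (i,j)"
    proof (cases "i = j")
      case False
      then show ?thesis using corthogonalD[OF ws(2), of j i] ij ws(3) by simp
    next
      case True
      have ne: "ws ! i \<bullet>c ws ! i \<noteq> 0" using corthogonalD[OF ws(2), of i i] ij ws(3) by simp
      \<comment> \<open>The order on complex numbers also requires equal imaginary parts, so this
        inequality says in particular that the product is real.\<close>
      have ge: "0 \<le> ws ! i \<bullet>c ws ! i" by (rule conjugate_square_ge_0_vec)
      define r where "r = Re (ws ! i \<bullet>c ws ! i)"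
      have r: "ws ! i \<bullet>c ws ! i = complex_of_real r" "0 < r"
        using ne ge unfolding r_def by (auto simp: less_eq_complex_def complex_eq_iff)
      have "complex_of_real (sqrt r) * complex_of_real (sqrt r) = complex_of_real r"
        using r(2) by (simp flip: of_real_mult)
      then show ?thesis using True ij r unfolding c_def by (simp add: field_simps)
    qed
    finally show "(mat_adjoint W * W) $$ (i,j) = 1\<^sub>m n $$ (i,j)" .
  qed (use W in auto)
  then show ?thesis using n col[OF n] hd by auto
qed

text \<open>By symmetry the first row of \<open>B\<close> vanishes off the diagonal as well, so
  \<open>B\<close> is block diagonal with a real scalar block and a Hermitian block \<open>C\<close>
  of order \<open>n\<close>. A unitary \<open>U\<close> that diagonalizes \<open>C\<close> extends
  to the block matrix \<open>V\<close> with blocks 1 and \<open>U\<close>.\<close>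

lemma hermitian_deflation:
  fixes B :: "complex mat"
  assumes B: "hermitian_mat (Suc n) B" and z: "\<And>i. i < Suc n \<Longrightarrow> i \<noteq> 0 \<Longrightarrow> B $$ (i,0) = 0"
    and IH: "\<And>C. hermitian_mat n C \<Longrightarrow> \<exists>U d. unitary_mat n U \<and> C = unitary_diag n U d"
  shows "\<exists>U d. unitary_mat (Suc n) U \<and> B = unitary_diag (Suc n) U d"
proof -
  have Bc: "B \<in> carrier_mat (Suc n) (Suc n)" and Ba: "mat_adjoint B = B"
    using B unfolding hermitian_mat_def by auto
  have sym: "B $$ (i,j) = cnj (B $$ (j,i))" if "i < Suc n" "j < Suc n" for i j
    using index_mat_adjoint[of i B j] that Bc unfolding Ba by simp
  define C where "C = mat n n (\<lambda>(i,j). B $$ (Suc i, Suc j))"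
  have "hermitian_mat n C"
    unfolding hermitian_mat_def C_def by (auto simp flip: sym)
  from IH[OF this] obtain U d where U: "unitary_mat n U" and CU: "C = unitary_diag n U d" by auto
  note u = unitary_matD[OF U]
  define V where "V = mat (Suc n) (Suc n)
    (\<lambda>(i,j). case (i,j) of (Suc i, Suc j) \<Rightarrow> U $$ (i,j) | (0,0) \<Rightarrow> 1 | _ \<Rightarrow> 0)"
  have V: "V \<in> carrier_mat (Suc n) (Suc n)" unfolding V_def by simp
  have Vi: "V $$ (0,0) = 1" "i < n \<Longrightarrow> V $$ (Suc i,0) = 0" "i < n \<Longrightarrow> V $$ (0,Suc i) = 0"
    "i < n \<Longrightarrow> j < n \<Longrightarrow> V $$ (Suc i,Suc j) = U $$ (i,j)" for i j
    unfolding V_def by auto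
  have UU: "(\<Sum>k<n. cnj (U $$ (k,i)) * U $$ (k,j)) = (if i = j then 1 else 0)" if "i < n" "j < n" for i j
    using arg_cong[OF u(3), of "\<lambda>M. M $$ (i,j)"] that u(1)
    by (simp add: scalar_prod_def lessThan_atLeast0)
  have "unitary_mat (Suc n) V"
  proof (rule unitary_matI[OF V], intro eq_matI)
    fix i j assume "i < dim_row (1\<^sub>m (Suc n) :: complex mat)" "j < dim_col (1\<^sub>m (Suc n) :: complex mat)"
    then have ij: "i < Suc n" "j < Suc n" by auto
    have "(mat_adjoint V * V) $$ (i,j) = (\<Sum>k<Suc n. cnj (V $$ (k,i)) * V $$ (k,j))"
      using V ij by (auto simp: scalar_prod_def lessThan_atLeast0 intro!: sum.cong)
    also have "\<dots> = 1\<^sub>m (Suc n) $$ (i,j)"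
      using ij unfolding sum.lessThan_Suc_shift
      by (cases i; cases j) (auto simp: Vi UU)
    finally show "(mat_adjoint V * V) $$ (i,j) = 1\<^sub>m (Suc n) $$ (i,j)" .
  qed (use V in auto)
  \<comment> \<open>The corner entry of \<open>B\<close> is put in front of the eigenvalues of
    \<open>C\<close>.\<close>
  moreover define e where "e = case_nat (Re (B $$ (0,0))) d"
  have "B = unitary_diag (Suc n) V e"
  proof (intro eq_matI)
    fix i j assume "i < dim_row (unitary_diag (Suc n) V e)" "j < dim_col (unitary_diag (Suc n) V e)"
    then have ij: "i < Suc n" "j < Suc n" using V by auto
    \<comment> \<open>A diagonal entry of a Hermitian matrix equals its own conjugate; the sequence
      \<open>e\<close> must be real.\<close>
    have B00: "B $$ (0,0) = complex_of_real (Re (B $$ (0,0)))"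
      using sym[of 0 0] by (simp add: complex_eq_iff)
    have BC: "B $$ (Suc i, Suc j) = (\<Sum>k<n. U $$ (i,k) * complex_of_real (d k) * cnj (U $$ (j,k)))"
      if "i < n" "j < n" for i j
      using arg_cong[OF CU, of "\<lambda>M. M $$ (i,j)"] that unitary_diag_index[OF u(1)] unfolding C_def by simp
    have B0: "B $$ (Suc i, 0) = 0" "B $$ (0, Suc i) = 0" if "i < n" for i
      using z[of "Suc i"] sym[of 0 "Suc i"] that by auto
    show "B $$ (i,j) = unitary_diag (Suc n) V e $$ (i,j)"
      unfolding unitary_diag_index[OF V ij] sum.lessThan_Suc_shift
      using ij B00 by (cases i; cases j) (auto simp: Vi e_def B0 BC)
  qed (use Bc V in auto)
  ultimately show ?thesis by blast
qed

lemma hermitian_mat_conj: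
  assumes "hermitian_mat n A" "W \<in> carrier_mat n n"
  shows "hermitian_mat n (mat_adjoint W * A * W)"
  using assms unfolding hermitian_mat_def
  by (auto simp: mat_adjoint_mult[of _ n n _ n] assoc_mult_mat[of _ n n _ n _ n])

text \<open>The spectral theorem. Over the complex numbers some eigenvector exists; let
  \<open>W\<close> be unitary with a multiple of it as first column. The first column of
  \<open>B\<close>, the conjugate of \<open>A\<close> by \<open>W\<close>, is then a multiple of the
  first unit vector, so deflation applies to \<open>B\<close>. Undoing the conjugation diagonalizes
  \<open>A\<close> by \<open>W * U\<close>.\<close>

lemma hermitian_mat_unitary_diagonalization:
  "hermitian_mat n A \<Longrightarrow> \<exists>U d. unitary_mat n U \<and> A = unitary_diag n U d"
proof (induction n arbitrary: A)
  case 0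
  have "unitary_mat 0 (1\<^sub>m 0)" by (intro unitary_matI eq_matI) auto
  moreover have "A = unitary_diag 0 (1\<^sub>m 0) (\<lambda>_. 0)"
    using 0 unfolding hermitian_mat_def
    by auto
  ultimately show ?case by blast
next
  case (Suc n A)
  let ?N = "Suc n"
  have A: "A \<in> carrier_mat ?N ?N" using Suc.prems unfolding hermitian_mat_def by auto
  obtain e v where v: "v \<in> carrier_vec ?N" "v \<noteq> 0\<^sub>v ?N" and Av: "A *\<^sub>v v = e \<cdot>\<^sub>v v"
    using spectrum_non_empty[OF A] A unfolding spectrum_def eigenvalue_def eigenvector_def by auto
  from normalized_col_basis[OF v] obtain W c where W: "unitary_mat ?N W" and c: "col W 0 = c \<cdot>\<^sub>v v"
    by auto
  note w = unitary_matD[OF W]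
  define B where "B = mat_adjoint W * A * W"
  have B: "B \<in> carrier_mat ?N ?N" unfolding B_def using w A by simp
  have "A *\<^sub>v col W 0 = e \<cdot>\<^sub>v col W 0"
    unfolding c using A v by (simp add: mult_mat_vec[OF A v(1)] Av smult_smult_assoc mult.commute)
  then have AW: "col (A * W) 0 = e \<cdot>\<^sub>v col W 0" using col_mult2[OF A w(1), of 0] by simp
  have W0: "col W 0 \<in> carrier_vec ?N" using col_dim[of W 0] w(1) by simp
  \<comment> \<open>The first column of \<open>A * W\<close> is \<open>e\<close> times that of
    \<open>W\<close>, and the adjoint of \<open>W\<close> sends the first column of \<open>W\<close>
    to the first unit vector.\<close>
  have "col B 0 = col (mat_adjoint W * (A * W)) 0"
    unfolding B_def using assoc_mult_mat[OF w(2) A w(1)] by simp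
  also have "\<dots> = e \<cdot>\<^sub>v (mat_adjoint W *\<^sub>v col W 0)"
    using A w(1) by (subst col_mult2[OF w(2)]) (auto simp: AW mult_mat_vec[OF w(2) W0])
  also have "mat_adjoint W *\<^sub>v col W 0 = col (mat_adjoint W * W) 0"
    using col_mult2[OF w(2,1), of 0] by simp
  finally have "col B 0 = e \<cdot>\<^sub>v col (mat_adjoint W * W) 0" .
  then have cB: "col B 0 = e \<cdot>\<^sub>v unit_vec ?N 0" unfolding w(3) by simp
  have "B $$ (i,0) = 0" if "i < ?N" "i \<noteq> 0" for i
    using arg_cong[OF cB, of "\<lambda>x. x $ i"] B that by simp
  from hermitian_deflation[OF hermitian_mat_conj[OF Suc.prems w(1), folded B_def] this Suc.IH]
  obtain U d where U: "unitary_mat ?N U" and BU: "B = unitary_diag ?N U d" by blast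
  note u = unitary_matD[OF U]
  have D: "mat_diag ?N d \<in> carrier_mat ?N ?N" for d :: "nat \<Rightarrow> complex" by simp
  note a = assoc_mult_mat[of _ ?N ?N _ ?N _ ?N]
  have "A = (W * mat_adjoint W) * A * (W * mat_adjoint W)" unfolding w(4) using A by simp
  also have "\<dots> = W * B * mat_adjoint W" unfolding B_def using w(1,2) A by (simp add: a)
  also have "\<dots> = unitary_diag ?N (W * U) d"
    unfolding BU unitary_diag_def using w(1,2) u(1,2) D
    by (simp add: a mat_adjoint_mult[of _ ?N ?N _ ?N])
  finally show ?case using unitary_mat_mult[OF W U] by blast
qed

section \<open>Spectra and quadratic forms\<close>

lemma cscalar_prod_self:
  fixes v :: "complex vec"
  assumes "v \<in> carrier_vec n"
  shows "v \<bullet>c v = complex_of_real (\<Sum>i<n. (cmod (v $ i))\<^sup>2)"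
proof -
  have "v $ i * cnj (v $ i) = complex_of_real ((cmod (v $ i))\<^sup>2)" for i
    by (rule complex_norm_square[symmetric])
  then show ?thesis
    using assms by (auto simp: scalar_prod_def lessThan_atLeast0 intro!: sum.cong)
qed

text \<open>Parseval's identity for the orthonormal columns of \<open>U\<close>. It makes the
  weights in a Rayleigh quotient sum to one.\<close>

lemma unitary_adjoint_cscalar_prod:
  assumes U: "unitary_mat n U" and v: "v \<in> carrier_vec n"
  shows "(mat_adjoint U *\<^sub>v v) \<bullet>c (mat_adjoint U *\<^sub>v v) = v \<bullet>c v"
proof -
  note u = unitary_matD[OF U]
  have "(mat_adjoint U *\<^sub>v v) \<bullet>c (mat_adjoint U *\<^sub>v v)
      = v \<bullet>c (U *\<^sub>v (mat_adjoint U *\<^sub>v v))"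
    using scalar_prod_mat_adjoint[OF u(2) v mult_mat_vec_carrier[OF u(2) v]] by simp
  also have "U *\<^sub>v (mat_adjoint U *\<^sub>v v) = v"
    using assoc_mult_mat_vec[OF u(1,2) v] u(4) v by simp
  finally show ?thesis .
qed

lemma mat_diag_mult_vec:
  fixes w :: "complex vec"
  assumes "w \<in> carrier_vec n"
  shows "mat_diag n g *\<^sub>v w = vec n (\<lambda>i. g i * w $ i)"
  using assms
  by (intro eq_vecI) (auto simp: mat_diag_def scalar_prod_def if_distrib[of "\<lambda>x. x * _"]
      cong: if_cong)

lemma unitary_diag_mult_vec:
  assumes U: "U \<in> carrier_mat n n" and v: "v \<in> carrier_vec n"
  shows "unitary_diag n U d *\<^sub>v v
    = U *\<^sub>v vec n (\<lambda>i. complex_of_real (d i) * (mat_adjoint U *\<^sub>v v) $ i)"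
proof -
  have D: "mat_diag n (\<lambda>i. complex_of_real (d i)) \<in> carrier_mat n n" by simp
  have U': "mat_adjoint U \<in> carrier_mat n n" using U by simp
  have "unitary_diag n U d *\<^sub>v v
      = U *\<^sub>v (mat_diag n (\<lambda>i. complex_of_real (d i)) *\<^sub>v (mat_adjoint U *\<^sub>v v))"
    unfolding unitary_diag_def using U U' D v
    by (simp add: assoc_mult_mat_vec[of _ n n _ n] mult_mat_vec_carrier[of _ n n])
  then show ?thesis
    by (simp add: mat_diag_mult_vec[OF mult_mat_vec_carrier[OF U' v]])
qed

text \<open>Moving the left factor \<open>U\<close> to the second argument turns both arguments into
  coordinates with respect to the columns of \<open>U\<close>, where the matrix acts
  diagonally.\<close>

lemma unitary_diag_quadratic_form:
  assumes U: "U \<in> carrier_mat n n" and v: "v \<in> carrier_vec n"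
  shows "(unitary_diag n U d *\<^sub>v v) \<bullet>c v
    = complex_of_real (\<Sum>i<n. d i * (cmod ((mat_adjoint U *\<^sub>v v) $ i))\<^sup>2)"
proof -
  define w where "w = mat_adjoint U *\<^sub>v v"
  have w: "w \<in> carrier_vec n" unfolding w_def using U v by (simp add: mult_mat_vec_carrier[of _ n n])
  have sq: "w $ i * cnj (w $ i) = complex_of_real ((cmod (w $ i))\<^sup>2)" for i
    by (rule complex_norm_square[symmetric])
  have "(unitary_diag n U d *\<^sub>v v) \<bullet>c v = vec n (\<lambda>i. complex_of_real (d i) * w $ i) \<bullet>c w"
    unfolding unitary_diag_mult_vec[OF U v] w_def
    by (rule scalar_prod_mat_adjoint[OF U _ v]) simp
  also have "\<dots> = complex_of_real (\<Sum>i<n. d i * (cmod (w $ i))\<^sup>2)"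
    using w by (auto simp: scalar_prod_def lessThan_atLeast0 mult.assoc sq simp del: of_real_power
        intro!: sum.cong)
  finally show ?thesis unfolding w_def .
qed

text \<open>In the coordinates \<open>w\<close> of an eigenvector the eigenvalue equation reads
  \<open>d i * w $ i = \<mu> * w $ i\<close> for each \<open>i\<close>, and some coordinate is
  non-zero. Conversely, column \<open>i\<close> of \<open>U\<close> is an eigenvector for
  \<open>d i\<close>.\<close>

lemma spectrum_unitary_diag:
  assumes U: "unitary_mat n U"
  shows "spectrum (unitary_diag n U d) = (\<lambda>i. complex_of_real (d i)) ` {..<n}"
proof (intro equalityI subsetI)
  note u = unitary_matD[OF U]
  fix \<mu> assume "\<mu> \<in> spectrum (unitary_diag n U d)"
  then obtain v where v: "v \<in> carrier_vec n" "v \<noteq> 0\<^sub>v n"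
    and ev: "unitary_diag n U d *\<^sub>v v = \<mu> \<cdot>\<^sub>v v"
    using u(1) unfolding spectrum_def eigenvalue_def eigenvector_def by auto
  define w where "w = mat_adjoint U *\<^sub>v v"
  define z where "z = vec n (\<lambda>i. complex_of_real (d i) * w $ i)"
  have w: "w \<in> carrier_vec n" unfolding w_def using u(2) v by (simp add: mult_mat_vec_carrier[of _ n n])
  have z: "z \<in> carrier_vec n" unfolding z_def by simp
  have Uw: "U *\<^sub>v w = v" unfolding w_def using assoc_mult_mat_vec[OF u(1,2) v(1)] u(4) v by simp
  \<comment> \<open>The eigenvalue equation says that \<open>U\<close> maps \<open>z\<close> to
    \<open>\<mu> \<cdot>\<^sub>v v\<close>; applying the adjoint of \<open>U\<close> translates it
    into coordinates.\<close>
  have "z = (mat_adjoint U * U) *\<^sub>v z" unfolding u(3) using z by simp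
  also have "\<dots> = mat_adjoint U *\<^sub>v (U *\<^sub>v z)" using u(2,1) z by (rule assoc_mult_mat_vec)
  also have "U *\<^sub>v z = \<mu> \<cdot>\<^sub>v v"
    using ev unfolding unitary_diag_mult_vec[OF u(1) v(1)] z_def w_def .
  also have "mat_adjoint U *\<^sub>v (\<mu> \<cdot>\<^sub>v v) = \<mu> \<cdot>\<^sub>v w"
    unfolding w_def using u(2) v(1) by (rule mult_mat_vec)
  finally have zw: "z = \<mu> \<cdot>\<^sub>v w" .
  have "w \<noteq> 0\<^sub>v n"
  proof
    assume "w = 0\<^sub>v n"
    then have "v = 0\<^sub>v n" using Uw u(1) by auto
    with v(2) show False by simp
  qed
  then obtain i where i: "i < n" "w $ i \<noteq> 0"
    using w by (metis carrier_vecD eq_vecI index_zero_vec(1) index_zero_vec(2))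
  have "complex_of_real (d i) * w $ i = \<mu> * w $ i"
    using arg_cong[OF zw, of "\<lambda>x. x $ i"] i w unfolding z_def by simp
  then show "\<mu> \<in> (\<lambda>i. complex_of_real (d i)) ` {..<n}" using i by auto
next
  note u = unitary_matD[OF U]
  fix \<mu> assume "\<mu> \<in> (\<lambda>i. complex_of_real (d i)) ` {..<n}"
  then obtain i where i: "i < n" and \<mu>: "\<mu> = complex_of_real (d i)" by auto
  have c: "col U i \<in> carrier_vec n" using col_dim[of U i] u(1) by simp
  have Uc: "mat_adjoint U *\<^sub>v col U i = unit_vec n i"
    using col_mult2[OF u(2,1) i] i unfolding u(3) by simp
  have "vec n (\<lambda>j. complex_of_real (d j) * unit_vec n i $ j) = \<mu> \<cdot>\<^sub>v unit_vec n i"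
    unfolding \<mu> by (intro eq_vecI) (auto simp: unit_vec_def)
  then have "unitary_diag n U d *\<^sub>v col U i = \<mu> \<cdot>\<^sub>v (U *\<^sub>v unit_vec n i)"
    unfolding unitary_diag_mult_vec[OF u(1) c] Uc
    using mult_mat_vec[OF u(1), of "unit_vec n i"] by simp
  also have "U *\<^sub>v unit_vec n i = col U i"
    using col_mult2[OF u(1) one_carrier_mat i] u(1) i by simp
  finally have "unitary_diag n U d *\<^sub>v col U i = \<mu> \<cdot>\<^sub>v col U i" .
  moreover have "col U i \<noteq> 0\<^sub>v n"
  proof
    assume "col U i = 0\<^sub>v n"
    moreover have "mat_adjoint U *\<^sub>v 0\<^sub>v n = 0\<^sub>v n"
      using u(1) by (intro eq_vecI) auto
    ultimately have "unit_vec n i = (0\<^sub>v n :: complex vec)" using Uc by simp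
    then show False using i by simp
  qed
  ultimately show "\<mu> \<in> spectrum (unitary_diag n U d)"
    unfolding spectrum_def eigenvalue_def eigenvector_def using u(1) c by auto
qed

lemma spectrum_in_unitary_diag:
  assumes "unitary_mat n U"
  shows "spectrum_in (unitary_diag n U d) K \<longleftrightarrow> (\<forall>i<n. d i \<in> K)"
  unfolding spectrum_in_def spectrum_unitary_diag[OF assms] by fastforce

lemma hermitian_spectrum_inE:
  assumes "hermitian_mat n A" "spectrum_in A K"
  obtains U d where "unitary_mat n U" "A = unitary_diag n U d" "\<And>i. i < n \<Longrightarrow> d i \<in> K"
  using hermitian_mat_unitary_diagonalization[OF assms(1)] assms(2)
  by (auto simp: spectrum_in_unitary_diag)

lemma psd_mats_unitary_diag:
  assumes U: "unitary_mat n U" and d: "\<And>i. i < n \<Longrightarrow> 0 \<le> d i"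
  shows "unitary_diag n U d \<in> psd_mats n"
  unfolding psd_mats_def
  using d by (auto simp: unitary_diag_quadratic_form[OF unitary_matD(1)[OF U]]
      hermitian_mat_unitary_diag[OF unitary_matD(1)[OF U]] intro!: sum_nonneg simp del: of_real_sum)

lemma hermitian_spectrum_nonneg:
  assumes "hermitian_mat n A" "spectrum_in A K" "K \<subseteq> {0..}"
  shows "A \<in> psd_mats n"
  using hermitian_spectrum_inE[OF assms(1,2)] psd_mats_unitary_diag assms(3)
  by (metis atLeast_iff subsetD)

lemma hermitian_mat_add:
  assumes "hermitian_mat n A" "hermitian_mat n B"
  shows "hermitian_mat n (A + B)"
  using assms unfolding hermitian_mat_def by (auto simp: mat_adjoint_add[of _ n n])

lemma hermitian_mat_smult:
  assumes "hermitian_mat n A"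
  shows "hermitian_mat n (complex_of_real c \<cdot>\<^sub>m A)"
  using assms unfolding hermitian_mat_def by (auto simp: mat_adjoint_smult)

text \<open>The Rayleigh quotient at \<open>v\<close> is an average of the eigenvalues: the weights
  are the squared moduli of the coordinates of \<open>v\<close> in an eigenbasis, divided by the
  squared norm of \<open>v\<close>. They are nonnegative and sum to one, so the average stays in the
  convex set \<open>S\<close>.\<close>

lemma quadratic_form_in_convex:
  assumes A: "hermitian_mat n A" "spectrum_in A S" and S: "convex S"
    and v: "v \<in> carrier_vec n" "v \<noteq> 0\<^sub>v n"
  shows "\<exists>s\<in>S. (A *\<^sub>v v) \<bullet>c v = complex_of_real s * (v \<bullet>c v)"
proof -
  from hermitian_spectrum_inE[OF A] obtain U d where U: "unitary_mat n U"
    and AU: "A = unitary_diag n U d" and d: "\<And>i. i < n \<Longrightarrow> d i \<in> S" by blast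
  note u = unitary_matD[OF U]
  define w where "w = mat_adjoint U *\<^sub>v v"
  have w: "w \<in> carrier_vec n" unfolding w_def using u(2) v by (simp add: mult_mat_vec_carrier[of _ n n])
  define N where "N = (\<Sum>i<n. (cmod (w $ i))\<^sup>2)"
  have vN: "v \<bullet>c v = complex_of_real N"
    using unitary_adjoint_cscalar_prod[OF U v(1)] cscalar_prod_self[OF w] unfolding w_def N_def by simp
  have "N \<noteq> 0" using vN v by (auto simp: conjugate_square_eq_0_vec)
  define s where "s = (\<Sum>i<n. ((cmod (w $ i))\<^sup>2 / N) *\<^sub>R d i)"
  have "0 \<le> N" unfolding N_def by (intro sum_nonneg) simp
  have "s \<in> S" unfolding s_def
  proof (rule convex_sum)
    show "(\<Sum>i<n. (cmod (w $ i))\<^sup>2 / N) = 1"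
      using \<open>N \<noteq> 0\<close> unfolding sum_divide_distrib[symmetric] N_def[symmetric] by simp
  qed (use S d \<open>0 \<le> N\<close> in auto)
  moreover have "(A *\<^sub>v v) \<bullet>c v = complex_of_real (s * N)"
  proof -
    have "s * N = (\<Sum>i<n. d i * (cmod (w $ i))\<^sup>2)"
      unfolding s_def sum_distrib_right using \<open>N \<noteq> 0\<close> by (intro sum.cong) auto
    then show ?thesis unfolding AU unitary_diag_quadratic_form[OF u(1) v(1)] w_def by simp
  qed
  ultimately show ?thesis unfolding vN by (auto simp flip: of_real_mult)
qed

text \<open>The matrices need not commute, so their eigenvalues cannot be combined one by one.
  Pairing the eigenvalue equation with the eigenvector \<open>v\<close> instead shows that the
  eigenvalue is the same convex combination of the Rayleigh quotients of \<open>A\<close> and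
  \<open>B\<close> at \<open>v\<close>, and both of these lie in \<open>S\<close>.\<close>

lemma spectrum_in_convex_comb:
  assumes A: "hermitian_mat n A" "spectrum_in A S" and B: "hermitian_mat n B" "spectrum_in B S"
    and S: "convex S" and t: "0 \<le> t" "t \<le> 1"
  shows "spectrum_in (complex_of_real t \<cdot>\<^sub>m A + complex_of_real (1 - t) \<cdot>\<^sub>m B) S" (is "spectrum_in ?M S")
  unfolding spectrum_in_def
proof
  fix \<mu> assume "\<mu> \<in> spectrum ?M"
  have c: "A \<in> carrier_mat n n" "B \<in> carrier_mat n n" using A B unfolding hermitian_mat_def by auto
  from \<open>\<mu> \<in> spectrum ?M\<close> obtain v where v: "v \<in> carrier_vec n" "v \<noteq> 0\<^sub>v n"
    and ev: "?M *\<^sub>v v = \<mu> \<cdot>\<^sub>v v"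
    using c unfolding spectrum_def eigenvalue_def eigenvector_def by auto
  obtain a b where ab: "a \<in> S" "b \<in> S" "(A *\<^sub>v v) \<bullet>c v = complex_of_real a * (v \<bullet>c v)"
    "(B *\<^sub>v v) \<bullet>c v = complex_of_real b * (v \<bullet>c v)"
    using quadratic_form_in_convex[OF A S v] quadratic_form_in_convex[OF B S v] by blast
  have Av: "A *\<^sub>v v \<in> carrier_vec n" "B *\<^sub>v v \<in> carrier_vec n"
    using c v by (auto simp: mult_mat_vec_carrier[of _ n n])
  have sm: "(k \<cdot>\<^sub>m X) *\<^sub>v v = k \<cdot>\<^sub>v (X *\<^sub>v v)" if "X \<in> carrier_mat n n" for k X
    using that v(1) by (intro eq_vecI) auto
  have "\<mu> * (v \<bullet>c v) = (?M *\<^sub>v v) \<bullet>c v"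
    unfolding ev using v by (simp add: smult_scalar_prod_distrib[of _ n])
  also have "?M *\<^sub>v v = complex_of_real t \<cdot>\<^sub>v (A *\<^sub>v v) + complex_of_real (1 - t) \<cdot>\<^sub>v (B *\<^sub>v v)"
    using c v by (simp add: add_mult_distrib_mat_vec[of _ n n] sm)
  also have "\<dots> \<bullet>c v = complex_of_real (t * a + (1 - t) * b) * (v \<bullet>c v)"
    using v Av ab
    by (simp add: add_scalar_prod_distrib[of _ n] smult_scalar_prod_distrib[of _ n] algebra_simps)
  finally have "\<mu> = complex_of_real (t * a + (1 - t) * b)"
    using v by (auto simp: conjugate_square_eq_0_vec)
  moreover have "t * a + (1 - t) * b \<in> S"
    using convexD[OF S ab(1,2), of t "1 - t"] t by simp
  ultimately show "\<mu> \<in> complex_of_real ` S" by blast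
qed

section \<open>Functional calculus and the Loewner order\<close>

lemma hermitian_mat_carrier: "hermitian_mat n A \<Longrightarrow> A \<in> carrier_mat n n"
  unfolding hermitian_mat_def by simp

lemma hermitian_mat_fun:
  assumes "hermitian_mat n A"
  shows "hermitian_mat n (mat_fun f A)"
  using hermitian_mat_unitary_diagonalization[OF assms]
  by (auto simp: mat_fun_eq intro!: hermitian_mat_unitary_diag unitary_matD(1))

lemma spectrum_in_mat_fun:
  assumes "hermitian_mat n A" "spectrum_in A K" "f ` K \<subseteq> S"
  shows "spectrum_in (mat_fun f A) S"
proof -
  from hermitian_spectrum_inE[OF assms(1,2)] obtain U d where "unitary_mat n U"
    "A = unitary_diag n U d" "\<And>i. i < n \<Longrightarrow> d i \<in> K" by blast
  then show ?thesis using assms(3) by (auto simp: mat_fun_eq spectrum_in_unitary_diag)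
qed

text \<open>Inversion is asked for only on a set containing the spectrum, because the powers with
  exponents \<open>p\<close> and \<open>1 / p\<close> undo each other only on nonnegative
  numbers.\<close>

lemma mat_fun_inverse:
  assumes "hermitian_mat n A" "spectrum_in A K" "\<And>x. x \<in> K \<Longrightarrow> g (f x) = x"
  shows "mat_fun g (mat_fun f A) = A"
proof -
  from hermitian_spectrum_inE[OF assms(1,2)] obtain U d where U: "unitary_mat n U"
    and A: "A = unitary_diag n U d" and d: "\<And>i. i < n \<Longrightarrow> d i \<in> K" by blast
  have "unitary_diag n U (g \<circ> (f \<circ> d)) = unitary_diag n U d"
    using d assms(3) by (intro unitary_diag_cong unitary_matD(1)[OF U]) simp
  then show ?thesis unfolding A mat_fun_eq[OF U] .
qed

lemma psd_mats_mat_fun: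
  assumes "hermitian_mat n A" "spectrum_in A K" "\<And>x. x \<in> K \<Longrightarrow> 0 \<le> f x"
  shows "mat_fun f A \<in> psd_mats n"
  using hermitian_spectrum_nonneg[OF hermitian_mat_fun[OF assms(1)]
      spectrum_in_mat_fun[OF assms(1,2), of f "{0..}"]] assms(3) by auto

text \<open>The map \<open>x powr p\<close> turns the \<open>p\<close>-mean of two points of
  \<open>K\<close> into the ordinary average of their images. This makes
  \<open>spectrum_in_convex_comb\<close> available for \<open>p\<close>-th powers of
  matrices.\<close>

lemma convex_powr_image:
  assumes p: "p > 0" and K: "p_convex p K"
  shows "convex ((\<lambda>x. x powr p) ` K)"
proof (rule convexI)
  fix a b u v :: real
  assume ab: "a \<in> (\<lambda>x. x powr p) ` K" "b \<in> (\<lambda>x. x powr p) ` K" and uv: "0 \<le> u" "0 \<le> v" "u + v = 1"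
  then obtain x y where xy: "x \<in> K" "y \<in> K" "a = x powr p" "b = y powr p" by auto
  let ?s = "u * x powr p + (1 - u) * y powr p"
  have "?s powr (1 / p) \<in> K" using K xy uv unfolding p_convex_def by auto
  \<comment> \<open>The root is undone because \<open>?s\<close> is nonnegative.\<close>
  moreover have "(?s powr (1 / p)) powr p = ?s" using p uv by (simp add: powr_powr)
  ultimately have "?s \<in> (\<lambda>x. x powr p) ` K" by (metis imageI)
  moreover have "1 - u = v" using uv by simp
  ultimately show "u *\<^sub>R a + v *\<^sub>R b \<in> (\<lambda>x. x powr p) ` K" using xy by simp
qed

section \<open>The positive semidefinite cone and the Loewner order\<close>

lemma psd_mats_hermitian: "A \<in> psd_mats n \<Longrightarrow> hermitian_mat n A"
  unfolding psd_mats_def by simp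

lemma psd_mats_carrier: "A \<in> psd_mats n \<Longrightarrow> A \<in> carrier_mat n n"
  by (simp add: psd_mats_hermitian hermitian_mat_carrier)

lemma psd_mats_add:
  assumes "A \<in> psd_mats n" "B \<in> psd_mats n"
  shows "A + B \<in> psd_mats n"
proof -
  have c: "A \<in> carrier_mat n n" "B \<in> carrier_mat n n" using assms by (auto dest: psd_mats_carrier)
  have "((A + B) *\<^sub>v v) \<bullet>c v = (A *\<^sub>v v) \<bullet>c v + (B *\<^sub>v v) \<bullet>c v" if v: "v \<in> carrier_vec n" for v
    using c v mult_mat_vec_carrier[OF c(1) v] mult_mat_vec_carrier[OF c(2) v]
    by (simp add: add_mult_distrib_mat_vec[of _ n n] add_scalar_prod_distrib[of _ n])
  then show ?thesis using assms hermitian_mat_add unfolding psd_mats_def by auto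
qed

lemma psd_mats_smult:
  assumes A: "A \<in> psd_mats n" and c: "0 \<le> c"
  shows "complex_of_real c \<cdot>\<^sub>m A \<in> psd_mats n"
proof -
  have Ac: "A \<in> carrier_mat n n" using A by (rule psd_mats_carrier)
  have "((complex_of_real c \<cdot>\<^sub>m A) *\<^sub>v v) \<bullet>c v = complex_of_real c * ((A *\<^sub>v v) \<bullet>c v)"
    if v: "v \<in> carrier_vec n" for v
  proof -
    have "(complex_of_real c \<cdot>\<^sub>m A) *\<^sub>v v = complex_of_real c \<cdot>\<^sub>v (A *\<^sub>v v)"
      using Ac v by (intro eq_vecI) auto
    then show ?thesis
      using v mult_mat_vec_carrier[OF Ac v] by (simp add: smult_scalar_prod_distrib[of _ n])
  qed
  then show ?thesis using A c hermitian_mat_smult unfolding psd_mats_def by auto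
qed

lemma loewner_le_refl:
  assumes "A \<in> carrier_mat n n"
  shows "loewner_le n A A"
proof -
  have "A - A = 0\<^sub>m n n" using assms by auto
  moreover have "0\<^sub>m n n \<in> psd_mats n"
    unfolding psd_mats_def hermitian_mat_def
    by (auto simp: scalar_prod_def intro!: eq_matI)
  ultimately show ?thesis using assms unfolding loewner_le_def by simp
qed

lemma loewner_le_trans:
  assumes "loewner_le n A B" "loewner_le n B C"
  shows "loewner_le n A C"
proof -
  have c: "A \<in> carrier_mat n n" "B \<in> carrier_mat n n" "C \<in> carrier_mat n n"
    using assms unfolding loewner_le_def by auto
  have "C - A = (B - A) + (C - B)" using c by (intro eq_matI) auto
  then show ?thesis using assms c psd_mats_add[of "B - A" n "C - B"] unfolding loewner_le_def by simp
qed

lemma loewner_le_add: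
  assumes "loewner_le n A B" "loewner_le n C D"
  shows "loewner_le n (A + C) (B + D)"
proof -
  have c: "A \<in> carrier_mat n n" "B \<in> carrier_mat n n" "C \<in> carrier_mat n n" "D \<in> carrier_mat n n"
    using assms unfolding loewner_le_def by auto
  have "B + D - (A + C) = (B - A) + (D - C)" using c by (intro eq_matI) auto
  then show ?thesis using assms c psd_mats_add[of "B - A" n "D - C"] unfolding loewner_le_def by simp
qed

lemma loewner_le_smult:
  assumes "loewner_le n A B" "0 \<le> c"
  shows "loewner_le n (complex_of_real c \<cdot>\<^sub>m A) (complex_of_real c \<cdot>\<^sub>m B)"
proof -
  have c: "A \<in> carrier_mat n n" "B \<in> carrier_mat n n" using assms unfolding loewner_le_def by auto
  have "complex_of_real c \<cdot>\<^sub>m B - complex_of_real c \<cdot>\<^sub>m A = complex_of_real c \<cdot>\<^sub>m (B - A)"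
    using c by (intro eq_matI) (auto simp: algebra_simps)
  then show ?thesis using assms c psd_mats_smult[of "B - A" n c] unfolding loewner_le_def by simp
qed

text \<open>The difference is \<open>d - c\<close> times a positive semidefinite matrix. Through
  this lemma the nonnegativity of \<open>f\<close> allows a scalar inequality for \<open>h\<close>
  to be carried over to multiples of \<open>f(A i)\<close>.\<close>

lemma loewner_le_smult_psd:
  assumes A: "A \<in> psd_mats n" and "c \<le> d"
  shows "loewner_le n (complex_of_real c \<cdot>\<^sub>m A) (complex_of_real d \<cdot>\<^sub>m A)"
proof -
  have "complex_of_real d \<cdot>\<^sub>m A - complex_of_real c \<cdot>\<^sub>m A = complex_of_real (d - c) \<cdot>\<^sub>m A"
    using psd_mats_carrier[OF A] by (intro eq_matI) (auto simp: algebra_simps)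
  then show ?thesis using assms psd_mats_smult[OF A, of "d - c"] psd_mats_carrier[OF A]
    unfolding loewner_le_def by simp
qed

section \<open>Finite sums of matrices\<close>

lemma mat_sum_empty [simp]: "mat_sum n F {} = 0\<^sub>m n n"
proof -
  interpret abelian_group "module_mat TYPE(complex) n n" by (rule abelian_group_mat)
  show ?thesis unfolding mat_sum_def by (simp add: module_mat_simps)
qed

lemma mat_sum_carrier [simp]:
  assumes "\<And>i. i \<in> I \<Longrightarrow> F i \<in> carrier_mat n n"
  shows "mat_sum n F I \<in> carrier_mat n n"
proof -
  interpret abelian_group "module_mat TYPE(complex) n n" by (rule abelian_group_mat)
  show ?thesis using finsum_closed[of F I] assms unfolding mat_sum_def by (auto simp: module_mat_simps)
qed

lemma mat_sum_insert:
  assumes "finite I" "j \<notin> I" "\<And>i. i \<in> insert j I \<Longrightarrow> F i \<in> carrier_mat n n"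
  shows "mat_sum n F (insert j I) = F j + mat_sum n F I"
proof -
  interpret abelian_group "module_mat TYPE(complex) n n" by (rule abelian_group_mat)
  show ?thesis using finsum_insert[of I j F] assms unfolding mat_sum_def by (auto simp: module_mat_simps)
qed

lemma mat_sum_cong:
  assumes "\<And>i. i \<in> I \<Longrightarrow> F i = G i" "\<And>i. i \<in> I \<Longrightarrow> G i \<in> carrier_mat n n"
  shows "mat_sum n F I = mat_sum n G I"
proof -
  interpret abelian_group "module_mat TYPE(complex) n n" by (rule abelian_group_mat)
  show ?thesis using assms unfolding mat_sum_def
    by (intro finsum_cong') (auto simp: module_mat_simps)
qed

text \<open>The new summand is put last, to match a convex combination of the first \<open>k\<close>
  matrices as a block with the last one.\<close>

lemma mat_sum_Suc:
  assumes "\<And>i. i \<in> {1..Suc k} \<Longrightarrow> F i \<in> carrier_mat n n"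
  shows "mat_sum n F {1..Suc k} = mat_sum n F {1..k} + F (Suc k)"
proof -
  have "mat_sum n F {1..Suc k} = F (Suc k) + mat_sum n F {1..k}"
    using mat_sum_insert[of "{1..k}" "Suc k" F n] assms by (auto simp: atLeastAtMostSuc_conv)
  also have "\<dots> = mat_sum n F {1..k} + F (Suc k)"
    using assms by (intro comm_add_mat[of _ n n] mat_sum_carrier) auto
  finally show ?thesis .
qed

lemma smult_mat_sum:
  assumes "finite I" "\<And>i. i \<in> I \<Longrightarrow> F i \<in> carrier_mat n n"
  shows "c \<cdot>\<^sub>m mat_sum n F I = mat_sum n (\<lambda>i. c \<cdot>\<^sub>m F i) I"
  using assms
proof (induction I rule: finite_induct)
  case empty
  show ?case by auto
next
  case (insert j I)
  have "c \<cdot>\<^sub>m mat_sum n F (insert j I) = c \<cdot>\<^sub>m (F j + mat_sum n F I)"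
    using insert.hyps insert.prems by (subst mat_sum_insert) auto
  also have "\<dots> = c \<cdot>\<^sub>m F j + c \<cdot>\<^sub>m mat_sum n F I"
    using insert.prems by (intro add_smult_distrib_left_mat[of _ n n] mat_sum_carrier) auto
  also have "\<dots> = c \<cdot>\<^sub>m F j + mat_sum n (\<lambda>i. c \<cdot>\<^sub>m F i) I" using insert by simp
  also have "\<dots> = mat_sum n (\<lambda>i. c \<cdot>\<^sub>m F i) (insert j I)"
    using insert.hyps insert.prems by (subst mat_sum_insert) auto
  finally show ?case .
qed

lemma loewner_le_mat_sum:
  assumes "finite I" "\<And>i. i \<in> I \<Longrightarrow> loewner_le n (F i) (G i)"
  shows "loewner_le n (mat_sum n F I) (mat_sum n G I)"
  using assms
proof (induction I rule: finite_induct)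
  case empty
  show ?case by (simp add: loewner_le_refl)
next
  case (insert j I)
  have c: "F i \<in> carrier_mat n n" "G i \<in> carrier_mat n n" if "i \<in> insert j I" for i
    using insert.prems[OF that] unfolding loewner_le_def by auto
  have sums: "mat_sum n F (insert j I) = F j + mat_sum n F I"
    "mat_sum n G (insert j I) = G j + mat_sum n G I"
    by (rule mat_sum_insert[OF insert.hyps(1,2)], erule c)+
  show ?case using insert.IH insert.prems by (auto simp: sums intro!: loewner_le_add)
qed

section \<open>Passage from two matrices to \<open>k\<close> matrices\<close>

section \<open>Operator $(p,h)$-convexity\<close>

text \<open>The conclusion is stronger than the inequality so that the induction can go on: knowing
  that \<open>M\<close> is Hermitian with spectrum in the image of \<open>K\<close> under
  \<open>x powr p\<close>, one can take its \<open>p\<close>-th root and obtain a matrix with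
  spectrum in \<open>K\<close>, to which the two-matrix inequality applies.\<close>

lemma opgx_weighted_sum:
  fixes A :: "nat \<Rightarrow> complex mat" and \<alpha> :: "nat \<Rightarrow> real" and k :: nat
  assumes p: "p > 0" and J: "{0<..<1} \<subseteq> J" and K: "p_convex p K"
    and h0: "\<forall>x\<in>J. 0 \<le> h x" and hm: "super_multiplicative_on J h"
    and f: "f \<in> opgx p h K" and n: "n \<ge> 1"
    and k: "2 \<le> k"
    and A: "\<And>i. i \<in> {1..k} \<Longrightarrow> A i \<in> psd_mats n \<and> spectrum_in (A i) K"
    and \<alpha>: "\<And>i. i \<in> {1..k} \<Longrightarrow> \<alpha> i \<in> {0<..<1}" and sum1: "(\<Sum>i=1..k. \<alpha> i) = 1"
  defines "M \<equiv> mat_sum n (\<lambda>i. complex_of_real (\<alpha> i) \<cdot>\<^sub>m mat_powr (A i) p) {1..k}"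
  shows "hermitian_mat n M \<and> spectrum_in M ((\<lambda>x. x powr p) ` K) \<and>
    loewner_le n (mat_fun f (mat_powr M (1 / p)))
      (mat_sum n (\<lambda>i. complex_of_real (h (\<alpha> i)) \<cdot>\<^sub>m mat_fun f (A i)) {1..k})"
proof -
  note conv = convex_powr_image[OF p K]
  have K0: "K \<subseteq> {0..}" using K unfolding p_convex_def by auto
  have f0: "0 \<le> f x" if "x \<in> K" for x using f that unfolding opgx_def by auto
  have fconv: "loewner_le n
      (mat_fun f (mat_powr (complex_of_real t \<cdot>\<^sub>m mat_powr B p + complex_of_real (1 - t) \<cdot>\<^sub>m mat_powr C p) (1 / p)))
      (complex_of_real (h t) \<cdot>\<^sub>m mat_fun f B + complex_of_real (h (1 - t)) \<cdot>\<^sub>m mat_fun f C)"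
    if "B \<in> psd_mats n" "C \<in> psd_mats n" "spectrum_in B K" "spectrum_in C K" "t \<in> {0<..<1}" for B C t
    using f n that unfolding opgx_def by blast
  have powr: "hermitian_mat n (mat_powr B p)" "spectrum_in (mat_powr B p) ((\<lambda>x. x powr p) ` K)"
    "mat_fun f B \<in> psd_mats n" if "B \<in> psd_mats n \<and> spectrum_in B K" for B
    unfolding mat_powr_def
    using that hermitian_mat_fun spectrum_in_mat_fun[of n B K, OF _ _ subset_refl] psd_mats_mat_fun f0
    by (auto dest!: psd_mats_hermitian)
  have ss: "a \<cdot>\<^sub>m (b \<cdot>\<^sub>m B) = (a * b) \<cdot>\<^sub>m B" for a b and B :: "complex mat"
    by (intro eq_matI) auto
  have two: "{1..2} = {1, 2 :: nat}" by auto
  show ?thesis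
    using k A \<alpha> sum1 unfolding M_def
  \<comment> \<open>The weights vary in the induction because the step uses the hypothesis for the
    rescaled weights \<open>\<alpha> i / b\<close>; the matrices stay the same.\<close>
  proof (induction k arbitrary: \<alpha> rule: nat_induct_at_least)
    case base
    have A1: "A 1 \<in> psd_mats n \<and> spectrum_in (A 1) K" and A2: "A 2 \<in> psd_mats n \<and> spectrum_in (A 2) K"
      using base(1)[of 1] base(1)[of 2] by auto
    have a: "\<alpha> 1 \<in> {0<..<1}" "\<alpha> 2 = 1 - \<alpha> 1" using base(2)[of 1] base(3) unfolding two by auto
    have S: "mat_sum n F {1..2} = F 1 + F 2" if "F 1 \<in> carrier_mat n n" "F 2 \<in> carrier_mat n n"
      for F :: "nat \<Rightarrow> complex mat"
      using that mat_sum_insert[of "{2}" 1 F n] mat_sum_insert[of "{}" 2 F n] unfolding two by auto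
    have c: "mat_powr (A 1) p \<in> carrier_mat n n" "mat_powr (A 2) p \<in> carrier_mat n n"
      "mat_fun f (A 1) \<in> carrier_mat n n" "mat_fun f (A 2) \<in> carrier_mat n n"
      using powr[OF A1] powr[OF A2] by (auto dest: hermitian_mat_carrier psd_mats_carrier)
    have M: "mat_sum n (\<lambda>i. complex_of_real (\<alpha> i) \<cdot>\<^sub>m mat_powr (A i) p) {1..2}
        = complex_of_real (\<alpha> 1) \<cdot>\<^sub>m mat_powr (A 1) p + complex_of_real (1 - \<alpha> 1) \<cdot>\<^sub>m mat_powr (A 2) p"
      using c by (subst S) (simp_all only: a(2) smult_carrier_mat)
    have R: "mat_sum n (\<lambda>i. complex_of_real (h (\<alpha> i)) \<cdot>\<^sub>m mat_fun f (A i)) {1..2}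
        = complex_of_real (h (\<alpha> 1)) \<cdot>\<^sub>m mat_fun f (A 1) + complex_of_real (h (1 - \<alpha> 1)) \<cdot>\<^sub>m mat_fun f (A 2)"
      using c by (subst S) (simp_all only: a(2) smult_carrier_mat)
    show ?case
      unfolding M R
      using a(1) A1 A2
      by (intro conjI fconv hermitian_mat_add hermitian_mat_smult powr
          spectrum_in_convex_comb[OF powr(1,2)[OF A1] powr(1,2)[OF A2] conv]) auto
  next
    case (Suc k \<alpha>)
    \<comment> \<open>This is the total weight of the first \<open>k\<close> matrices, expressed
      through the last weight.\<close>
    define b where "b = 1 - \<alpha> (Suc k)"
    have b: "0 < b" "b < 1" and ak: "\<alpha> (Suc k) = 1 - b"
      using Suc.prems(2)[of "Suc k"] unfolding b_def by auto
    have sumb: "(\<Sum>i=1..k. \<alpha> i) = b" using Suc.prems(3) unfolding b_def by simp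
    \<comment> \<open>Since \<open>k\<close> is at least 2, another positive weight remains besides
      \<open>\<alpha> i\<close>. The strict inequality is what keeps \<open>\<alpha> i / b\<close>
      inside the open unit interval.\<close>
    have \<alpha>b: "\<alpha> i < b" if i: "i \<in> {1..k}" for i
    proof -
      have "card ({1..k} - {i}) \<noteq> 0" using Suc.hyps i by simp
      then have "{1..k} - {i} \<noteq> {}" by auto
      then have "0 < sum \<alpha> ({1..k} - {i})" using Suc.prems(2) by (intro sum_pos) auto
      then show ?thesis using sumb sum.remove[OF _ i, of \<alpha>] by simp
    qed
    have \<alpha>0: "\<alpha> i \<in> {0<..<1}" if "i \<in> {1..Suc k}" for i using Suc.prems(2)[OF that] .
    have Ai: "A i \<in> psd_mats n \<and> spectrum_in (A i) K" if "i \<in> {1..Suc k}" for i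
      using Suc.prems(1)[OF that] .
    have c: "mat_powr (A i) p \<in> carrier_mat n n" "mat_fun f (A i) \<in> carrier_mat n n"
      if "i \<in> {1..Suc k}" for i
      using powr[OF Ai[OF that]] by (auto dest: hermitian_mat_carrier psd_mats_carrier)
    define X where "X = mat_sum n (\<lambda>i. complex_of_real (\<alpha> i / b) \<cdot>\<^sub>m mat_powr (A i) p) {1..k}"
    define C where "C = mat_powr X (1 / p)"
    have weight: "\<alpha> i / b \<in> {0<..<1}" if "i \<in> {1..k}" for i
      using \<alpha>b[OF that] \<alpha>0[of i] that b by auto
    have "(\<Sum>i=1..k. \<alpha> i / b) = 1" using sumb b by (simp flip: sum_divide_distrib)
    with Suc.IH[of "\<lambda>i. \<alpha> i / b"] weight Ai
    have X: "hermitian_mat n X" "spectrum_in X ((\<lambda>x. x powr p) ` K)"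
      and IH: "loewner_le n (mat_fun f C)
        (mat_sum n (\<lambda>i. complex_of_real (h (\<alpha> i / b)) \<cdot>\<^sub>m mat_fun f (A i)) {1..k})"
      unfolding X_def C_def by auto
    have inv: "(x powr p) powr (1 / p) = x" if "x \<in> K" for x using p K0 that by (auto simp: powr_powr)
    \<comment> \<open>The eigenvalues of \<open>X\<close> are \<open>p\<close>-th powers of elements
      of \<open>K\<close>, so taking the root brings them back into \<open>K\<close>.\<close>
    have C: "hermitian_mat n C" "spectrum_in C K"
      unfolding C_def mat_powr_def
      using X hermitian_mat_fun spectrum_in_mat_fun[OF X] inv by (auto simp: image_subset_iff)
    then have Cpsd: "C \<in> psd_mats n" using hermitian_spectrum_nonneg K0 by blast
    \<comment> \<open>Hence the \<open>p\<close>-mean of \<open>C\<close> and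
      \<open>A (Suc k)\<close> with weights \<open>b\<close> and \<open>1 - b\<close> is exactly the
      \<open>p\<close>-mean of all \<open>Suc k\<close> matrices.\<close>
    have CX: "mat_powr C p = X"
      unfolding C_def mat_powr_def by (rule mat_fun_inverse[OF X]) (auto simp: inv)
    define M where "M = mat_sum n (\<lambda>i. complex_of_real (\<alpha> i) \<cdot>\<^sub>m mat_powr (A i) p) {1..Suc k}"
    have "complex_of_real b \<cdot>\<^sub>m X = mat_sum n (\<lambda>i. complex_of_real (\<alpha> i) \<cdot>\<^sub>m mat_powr (A i) p) {1..k}"
      unfolding X_def using c b by (subst smult_mat_sum) (auto intro!: mat_sum_cong simp: ss)
    then have M: "M = complex_of_real b \<cdot>\<^sub>m X + complex_of_real (1 - b) \<cdot>\<^sub>m mat_powr (A (Suc k)) p"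
      unfolding M_def using c by (subst mat_sum_Suc) (auto simp: ak)
    note As = Ai[of "Suc k", simplified]
    have "hermitian_mat n M"
      unfolding M by (intro hermitian_mat_add hermitian_mat_smult X powr As)
    moreover have "spectrum_in M ((\<lambda>x. x powr p) ` K)"
      unfolding M using b by (intro spectrum_in_convex_comb[OF X powr(1,2)[OF As] conv]) auto
    moreover have "loewner_le n (mat_fun f (mat_powr M (1 / p)))
      (mat_sum n (\<lambda>i. complex_of_real (h (\<alpha> i)) \<cdot>\<^sub>m mat_fun f (A i)) {1..Suc k})"
    proof (rule loewner_le_trans)
      show "loewner_le n (mat_fun f (mat_powr M (1 / p)))
        (complex_of_real (h b) \<cdot>\<^sub>m mat_fun f C + complex_of_real (h (1 - b)) \<cdot>\<^sub>m mat_fun f (A (Suc k)))"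
        using fconv[OF Cpsd _ C(2), of "A (Suc k)" b] As b unfolding M CX by simp
      \<comment> \<open>The sign is needed to multiply the induction hypothesis by
        \<open>h b\<close> without reversing the order.\<close>
      have hb: "0 \<le> h b" using h0 J b by auto
      have "loewner_le n (complex_of_real (h b) \<cdot>\<^sub>m mat_fun f C)
        (complex_of_real (h b) \<cdot>\<^sub>m
          mat_sum n (\<lambda>i. complex_of_real (h (\<alpha> i / b)) \<cdot>\<^sub>m mat_fun f (A i)) {1..k})"
        by (rule loewner_le_smult[OF IH hb])
      also have "complex_of_real (h b) \<cdot>\<^sub>m
          mat_sum n (\<lambda>i. complex_of_real (h (\<alpha> i / b)) \<cdot>\<^sub>m mat_fun f (A i)) {1..k}
        = mat_sum n (\<lambda>i. complex_of_real (h b * h (\<alpha> i / b)) \<cdot>\<^sub>m mat_fun f (A i)) {1..k}"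
        using c by (subst smult_mat_sum) (auto intro!: mat_sum_cong simp: ss)
      finally have 1: "loewner_le n (complex_of_real (h b) \<cdot>\<^sub>m mat_fun f C) \<dots>" .
      have 2: "loewner_le n \<dots>
        (mat_sum n (\<lambda>i. complex_of_real (h (\<alpha> i)) \<cdot>\<^sub>m mat_fun f (A i)) {1..k})"
      proof (intro loewner_le_mat_sum loewner_le_smult_psd powr Ai)
        fix i assume i: "i \<in> {1..k}"
        \<comment> \<open>Both factors and their product \<open>\<alpha> i\<close> lie in the open
          unit interval, hence in \<open>J\<close>, as the condition in super-multiplicativity
          demands.\<close>
        have "b \<in> J" "\<alpha> i / b \<in> J" "b * (\<alpha> i / b) \<in> J"
          using J b weight[OF i] \<alpha>0[of i] i by auto
        then have "h b * h (\<alpha> i / b) \<le> h (b * (\<alpha> i / b))"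
          using hm unfolding super_multiplicative_on_def by blast
        then show "h b * h (\<alpha> i / b) \<le> h (\<alpha> i)" using b by simp
      qed auto
      have "mat_sum n (\<lambda>i. complex_of_real (h (\<alpha> i)) \<cdot>\<^sub>m mat_fun f (A i)) {1..Suc k}
        = mat_sum n (\<lambda>i. complex_of_real (h (\<alpha> i)) \<cdot>\<^sub>m mat_fun f (A i)) {1..k}
          + complex_of_real (h (1 - b)) \<cdot>\<^sub>m mat_fun f (A (Suc k))"
        using c by (subst mat_sum_Suc) (auto simp: ak)
      then show "loewner_le n
        (complex_of_real (h b) \<cdot>\<^sub>m mat_fun f C + complex_of_real (h (1 - b)) \<cdot>\<^sub>m mat_fun f (A (Suc k)))
        (mat_sum n (\<lambda>i. complex_of_real (h (\<alpha> i)) \<cdot>\<^sub>m mat_fun f (A i)) {1..Suc k})"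
        using loewner_le_add[OF loewner_le_trans[OF 1 2] loewner_le_refl] c by simp
    qed
    ultimately show ?case unfolding M_def by blast
  qed
qed

theorem theorem3p1:
  fixes p :: real and J K :: "real set" and h f :: "real \<Rightarrow> real"
    and n k :: nat and A :: "nat \<Rightarrow> complex mat" and \<alpha> :: "nat \<Rightarrow> real"
  assumes "p > 0"
    and "is_interval J" and "J \<subseteq> {0..}" and "{0<..<1} \<subseteq> J"
    and "p_convex p K"
    and "\<forall>x\<in>J. 0 \<le> h x" and "\<exists>x\<in>J. h x \<noteq> 0" and "super_multiplicative_on J h"
    and "f \<in> opgx p h K"
    and "n \<ge> 1"
    and "\<forall>i\<in>{1..k}. A i \<in> psd_mats n \<and> spectrum_in (A i) K"
    and "\<forall>i\<in>{1..k}. \<alpha> i \<in> {0<..<1}" and "(\<Sum>i=1..k. \<alpha> i) = 1"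
  shows "loewner_le n
     (mat_fun f (mat_powr (mat_sum n (\<lambda>i. complex_of_real (\<alpha> i) \<cdot>\<^sub>m mat_powr (A i) p) {1..k}) (1 / p)))
     (mat_sum n (\<lambda>i. complex_of_real (h (\<alpha> i)) \<cdot>\<^sub>m mat_fun f (A i)) {1..k})"
proof -
  \<comment> \<open>The empty sum of weights would be 0, and a single weight would have to be 1,
    which is outside the open unit interval. So the induction may start at two.\<close>
  have "k \<noteq> 0" using assms(13) by (intro notI) simp
  moreover have "k \<noteq> 1" using assms(12,13) by (intro notI) simp
  ultimately have "2 \<le> k" by simp
  with assms show ?thesis
    using opgx_weighted_sum[of p J K h f n k A \<alpha>] by blast
qed

end
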